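(* Let $H$ be a complex Hilbert space and let $A\in\mathcal{B}(H)$ be antilinear. (1) Let $f(\lambda)=\sum_{k=-\infty}^{\infty}\alpha_k\lambda^k$ ($\alpha_k\in\mathbb{C}$) be a Laurent series converging in an open annulus centred at the origin (an open disc centred at the origin if $\alpha_k=0$ for all $k<0$), assume that $\sigma(A)$ is contained in this annulus (or disc), and assume that the operator $f(A)=\sum_{k=-\infty}^{\infty}\alpha_kA^k$ is defined. Put $$\hat f(\lambda)=\sum_{k=-\infty}^{\infty}(\alpha_{2k}+\alpha_{2k+1}\lambda)|\lambda|^{2k}.$$ Then $\hat f(\sigma(A))\subset\sigma(f(A))$. (2) If moreover $A$ is self-adjoint, then $\hat f(\sigma(A))\subset\sigma(f(A))$ holds for every continuous biradial function $\hat f:\sigma(A)\to\mathbb{C}$, $\hat f(\lambda)=u(|\lambda|^2)+v(|\lambda|^2)\lambda$ with $u,v:\sigma(A^2)\to\mathbb{C}$ continuous, where $f(A)=u(A^2)+v(A^2)A$.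
   Context: $\mathcal{B}(H)$ denotes the set of bounded real linear operators on $H$. An operator $A$ is antilinear if it is real linear and $A\lambda=\overline{\lambda}A$ for all $\lambda\in\mathbb{C}$. The adjoint $B^*$ of $B\in\mathcal{B}(H)$ is the real linear operator with $\mathrm{Re}(Bx,y)=\mathrm{Re}(x,B^*y)$ for all $x,y\in H$; $B$ is self-adjoint if $B^*=B$. The spectrum $\sigma(B)$ of $B\in\mathcal{B}(H)$ is the set of $\lambda\in\mathbb{C}$ such that $\lambda I-B$ (where $\lambda I$ is multiplication by the complex scalar $\lambda$) is not boundedly invertible as a real linear operator; it may be empty. In (1), "$f(A)$ is defined" means that the series $\sum_k\alpha_kA^k$ converges in operator norm, with $A$ boundedly invertible if some $\alpha_k\neq0$ with $k<0$; here $\alpha_kA^k$ is $A^k$ followed by multiplication by the scalar $\alpha_k$. For antilinear self-adjoint $A$, the operator $A^2$ is complex linear, self-adjoint and positive semidefinite; $\sigma(A^2)\subset[0,\infty)$ is compact, $u(A^2),v(A^2)$ are given by the continuous functional calculus, and $\lambda\in\sigma(A)$ if and only if $|\lambda|^2\in\sigma(A^2)$. *)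

theory Defs
  imports "HOL-Analysis.Analysis" "HOL-Computational_Algebra.Polynomial"
begin

text \<open>
  A complex Hilbert space is regarded as a real Hilbert space with real inner product
  \<open>Re (x, y)\<close> together with its complex structure. The inner product is linear in the first
  argument; the norm, inherited from \<^class>\<open>real_inner\<close>, is \<open>sqrt (Re (x, x)) = sqrt (x, x)\<close>.
\<close>

class complex_inner = real_inner +
  fixes scaleC :: "complex \<Rightarrow> 'a \<Rightarrow> 'a"  (infixr \<open>*\<^sub>C\<close> 75)
    and cinner :: "'a \<Rightarrow> 'a \<Rightarrow> complex"
  assumes scaleC_add_right: "a *\<^sub>C (x + y) = a *\<^sub>C x + a *\<^sub>C y"
    and scaleC_add_left: "(a + b) *\<^sub>C x = a *\<^sub>C x + b *\<^sub>C x"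
    and scaleC_scaleC: "a *\<^sub>C b *\<^sub>C x = (a * b) *\<^sub>C x"
    and scaleR_scaleC: "r *\<^sub>R x = complex_of_real r *\<^sub>C x"
    and cinner_commute: "cinner x y = cnj (cinner y x)"
    and cinner_add_left: "cinner (x + y) z = cinner x z + cinner y z"
    and cinner_scaleC_left: "cinner (a *\<^sub>C x) y = a * cinner x y"
    and inner_eq_Re_cinner: "inner x y = Re (cinner x y)"

class chilbert_space = complex_inner + complete_space
begin

subclass banach ..

end

instantiation complex :: chilbert_space
begin

definition scaleC_complex :: "complex \<Rightarrow> complex \<Rightarrow> complex" where
  "scaleC_complex a x = a * x"

definition cinner_complex :: "complex \<Rightarrow> complex \<Rightarrow> complex" where
  "cinner_complex x y = x * cnj y"

instance
  by standard (simp_all add: scaleC_complex_def cinner_complex_def algebra_simps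
      scaleR_conv_of_real inner_complex_def)

end

lemma norm_scaleC: "norm (a *\<^sub>C x) = cmod a * norm (x :: 'a::complex_inner)"
proof -
  have r: "cinner x (a *\<^sub>C x) = cnj a * cinner x x"
    by (metis cinner_commute cinner_scaleC_left complex_cnj_mult)
  have "inner (a *\<^sub>C x) (a *\<^sub>C x) = Re ((a * cnj a) * cinner x x)"
    by (simp add: inner_eq_Re_cinner cinner_scaleC_left r mult.assoc)
  also have "\<dots> = (cmod a)\<^sup>2 * inner x x"
    by (simp add: inner_eq_Re_cinner flip: complex_norm_square of_real_power)
  finally show ?thesis
    by (simp add: norm_eq_sqrt_inner real_sqrt_mult)
qed

text \<open>
  Bounded real linear operators are elements of the library type \<open>'a \<Rightarrow>\<^sub>L 'a\<close>, whose norm is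
  the operator norm.
\<close>

lift_definition scalar_op :: "complex \<Rightarrow> 'a::chilbert_space \<Rightarrow>\<^sub>L 'a" is "\<lambda>c x. c *\<^sub>C x"
proof -
  fix c :: complex
  show "bounded_linear (\<lambda>x::'a. c *\<^sub>C x)"
    by (rule bounded_linear_intro[where K = "cmod c"])
      (simp_all add: scaleC_add_right scaleR_scaleC scaleC_scaleC norm_scaleC mult.commute)
qed

definition antilinear :: "('a::chilbert_space \<Rightarrow>\<^sub>L 'a) \<Rightarrow> bool" where
  "antilinear A \<longleftrightarrow> (\<forall>c. A o\<^sub>L scalar_op c = scalar_op (cnj c) o\<^sub>L A)"

definition is_adjoint :: "('a::chilbert_space \<Rightarrow>\<^sub>L 'a) \<Rightarrow> ('a \<Rightarrow>\<^sub>L 'a) \<Rightarrow> bool" where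
  "is_adjoint B C \<longleftrightarrow> (\<forall>x y. Re (cinner (B x) y) = Re (cinner x (C y)))"

definition self_adjoint :: "('a::chilbert_space \<Rightarrow>\<^sub>L 'a) \<Rightarrow> bool" where
  "self_adjoint B \<longleftrightarrow> is_adjoint B B"

definition is_inverse_op :: "('a::real_normed_vector \<Rightarrow>\<^sub>L 'a) \<Rightarrow> ('a \<Rightarrow>\<^sub>L 'a) \<Rightarrow> bool" where
  "is_inverse_op B C \<longleftrightarrow> B o\<^sub>L C = id_blinfun \<and> C o\<^sub>L B = id_blinfun"

definition boundedly_invertible :: "('a::real_normed_vector \<Rightarrow>\<^sub>L 'a) \<Rightarrow> bool" where
  "boundedly_invertible B \<longleftrightarrow> (\<exists>C. is_inverse_op B C)"

definition inverse_op :: "('a::real_normed_vector \<Rightarrow>\<^sub>L 'a) \<Rightarrow> ('a \<Rightarrow>\<^sub>L 'a)" where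
  "inverse_op B = (THE C. is_inverse_op B C)"

definition spectrum :: "('a::chilbert_space \<Rightarrow>\<^sub>L 'a) \<Rightarrow> complex set" where
  "spectrum B = {c. \<not> boundedly_invertible (scalar_op c - B)}"

definition power_op :: "('a::real_normed_vector \<Rightarrow>\<^sub>L 'a) \<Rightarrow> nat \<Rightarrow> ('a \<Rightarrow>\<^sub>L 'a)" where
  "power_op B n = ((o\<^sub>L) B ^^ n) id_blinfun"

text \<open>For negative \<open>k\<close> this is meaningful only if \<open>B\<close> is boundedly invertible.\<close>

definition power_int_op :: "('a::real_normed_vector \<Rightarrow>\<^sub>L 'a) \<Rightarrow> int \<Rightarrow> ('a \<Rightarrow>\<^sub>L 'a)" where
  "power_int_op B k =
     (if 0 \<le> k then power_op B (nat k) else power_op (inverse_op B) (nat (- k)))"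

text \<open>
  A two-sided series converges if its parts with nonnegative and with negative index
  both converge.
\<close>

definition bi_summable :: "(int \<Rightarrow> 'b::real_normed_vector) \<Rightarrow> bool" where
  "bi_summable g \<longleftrightarrow> summable (\<lambda>n. g (int n)) \<and> summable (\<lambda>n. g (- int (Suc n)))"

definition bi_suminf :: "(int \<Rightarrow> 'b::real_normed_vector) \<Rightarrow> 'b" where
  "bi_suminf g = (\<Sum>n. g (int n)) + (\<Sum>n. g (- int (Suc n)))"

text \<open>
  The regions allowed for a Laurent series with coefficients \<open>\<alpha>\<close>: open annuli, and open discs if
  there are no negative powers. The outer radius may be infinite.
\<close>

definition laurent_region :: "(int \<Rightarrow> complex) \<Rightarrow> complex set \<Rightarrow> bool" where
  "laurent_region \<alpha> D \<longleftrightarrow>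
     (\<exists>(r::real) (R::ereal). 0 \<le> r \<and> ereal r < R \<and>
        D = {z. r < cmod z \<and> ereal (cmod z) < R}) \<or>
     ((\<forall>k<0. \<alpha> k = 0) \<and> (\<exists>R::ereal. 0 < R \<and> D = {z. ereal (cmod z) < R}))"

definition laurent_converges_on :: "(int \<Rightarrow> complex) \<Rightarrow> complex set \<Rightarrow> bool" where
  "laurent_converges_on \<alpha> D \<longleftrightarrow> (\<forall>z\<in>D. bi_summable (\<lambda>k. \<alpha> k * z powi k))"

definition laurent_op_defined ::
    "(int \<Rightarrow> complex) \<Rightarrow> ('a::chilbert_space \<Rightarrow>\<^sub>L 'a) \<Rightarrow> bool" where
  "laurent_op_defined \<alpha> A \<longleftrightarrow>
     ((\<exists>k<0. \<alpha> k \<noteq> 0) \<longrightarrow> boundedly_invertible A) \<and>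
     bi_summable (\<lambda>k. scalar_op (\<alpha> k) o\<^sub>L power_int_op A k)"

definition laurent_op ::
    "(int \<Rightarrow> complex) \<Rightarrow> ('a::chilbert_space \<Rightarrow>\<^sub>L 'a) \<Rightarrow> ('a \<Rightarrow>\<^sub>L 'a)" where
  "laurent_op \<alpha> A = bi_suminf (\<lambda>k. scalar_op (\<alpha> k) o\<^sub>L power_int_op A k)"

definition laurent_hat :: "(int \<Rightarrow> complex) \<Rightarrow> complex \<Rightarrow> complex" where
  "laurent_hat \<alpha> z =
     bi_suminf (\<lambda>k. (\<alpha> (2 * k) + \<alpha> (2 * k + 1) * z) * complex_of_real (cmod z powi (2 * k)))"

definition poly_op :: "complex poly \<Rightarrow> ('a::chilbert_space \<Rightarrow>\<^sub>L 'a) \<Rightarrow> ('a \<Rightarrow>\<^sub>L 'a)" where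
  "poly_op p B = (\<Sum>k\<le>degree p. scalar_op (coeff p k) o\<^sub>L power_op B k)"

text \<open>
  Continuous functional calculus for a complex linear self-adjoint operator \<open>B\<close> and a function
  \<open>u\<close> continuous on its (real) spectrum: \<open>u(B)\<close> is the operator norm limit of \<open>p\<^sub>n(B)\<close> whenever
  the polynomials \<open>p\<^sub>n\<close> converge to \<open>u\<close> uniformly on the spectrum. The values of \<open>u\<close> off the
  spectrum are irrelevant. For other \<open>B\<close> or \<open>u\<close> the definite description may be void.
\<close>

definition cfc :: "(complex \<Rightarrow> complex) \<Rightarrow> ('a::chilbert_space \<Rightarrow>\<^sub>L 'a) \<Rightarrow> ('a \<Rightarrow>\<^sub>L 'a)" where
  "cfc u B = (THE T. \<forall>p :: nat \<Rightarrow> complex poly.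
     uniform_limit (spectrum B) (\<lambda>n. poly (p n)) u sequentially \<longrightarrow>
     (\<lambda>n. poly_op (p n) B) \<longlonglongrightarrow> T)"

definition biradial :: "(complex \<Rightarrow> complex) \<Rightarrow> (complex \<Rightarrow> complex) \<Rightarrow> complex \<Rightarrow> complex" where
  "biradial u v z = u (complex_of_real ((cmod z)\<^sup>2)) + v (complex_of_real ((cmod z)\<^sup>2)) * z"

end

theory Submission
  imports Defs "HOL-Computational_Algebra.Fundamental_Theorem_Algebra"
begin

text \<open>
  For antilinear \<open>A\<close> the operators \<open>z - A\<close> and \<open>cnj z + A\<close> commute with product \<open>|z|\<^sup>2 - A\<^sup>2\<close>, and
  scalars move through \<open>z - A\<close> at the cost of rotating \<open>z\<close>. If \<open>f\<close> is a (Laurent) polynomial, then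
  the even part \<open>u\<close> and the odd part \<open>v\<close> satisfy \<open>u(|z|\<^sup>2) - u(A\<^sup>2) = P (|z|\<^sup>2 - A\<^sup>2)\<close> and similarly
  for \<open>v\<close>, so \<open>u(|z|\<^sup>2) + v(|z|\<^sup>2) z - f(A)\<close> is both a left multiple of \<open>z - A\<close> and a right multiple of
  \<open>w - A\<close> for a rotation \<open>w\<close> of \<open>z\<close>; hence it is not invertible if \<open>z\<close> is in the spectrum. Since
  invertibility is an open condition, the inclusion survives norm limits. This gives the Laurent
  series directly, and the biradial functions through polynomial approximation on the spectrum of
  the self-adjoint complex linear operator \<open>A\<^sup>2\<close>.
\<close>

section \<open>Bounded real linear operators\<close>

lemma blinfun_compose_assoc: "(f o\<^sub>L g) o\<^sub>L h = f o\<^sub>L (g o\<^sub>L h)"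
  by (rule blinfun_eqI) simp

lemma blinfun_compose_id [simp]: "f o\<^sub>L id_blinfun = f" "id_blinfun o\<^sub>L f = f"
  by (rule blinfun_eqI, simp)+

lemmas blinfun_compose_bilinear =
  bounded_bilinear.add_left[OF bounded_bilinear_blinfun_compose]
  bounded_bilinear.add_right[OF bounded_bilinear_blinfun_compose]
  bounded_bilinear.diff_left[OF bounded_bilinear_blinfun_compose]
  bounded_bilinear.diff_right[OF bounded_bilinear_blinfun_compose]
  bounded_bilinear.minus_left[OF bounded_bilinear_blinfun_compose]
  bounded_bilinear.minus_right[OF bounded_bilinear_blinfun_compose]
  bounded_bilinear.scaleR_left[OF bounded_bilinear_blinfun_compose]
  bounded_bilinear.scaleR_right[OF bounded_bilinear_blinfun_compose]

text \<open>One-sided inverses \<open>L\<close> and \<open>R\<close> agree, so they may be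
  constructed by unrelated arguments, as happens for \<open>scalar_op z - A\<close> below.\<close>

lemma boundedly_invertibleI:
  assumes "L o\<^sub>L B = id_blinfun" "B o\<^sub>L R = id_blinfun"
  shows "boundedly_invertible B"
proof -
  have "L = L o\<^sub>L (B o\<^sub>L R)"
    using assms(2) by simp
  also have "\<dots> = R"
    using assms(1) by (simp flip: blinfun_compose_assoc)
  finally show ?thesis
    using assms unfolding boundedly_invertible_def is_inverse_op_def by blast
qed

lemma boundedly_invertible_compose:
  assumes "boundedly_invertible B" "boundedly_invertible C"
  shows "boundedly_invertible (B o\<^sub>L C)"
proof -
  obtain B' C' where inv: "is_inverse_op B B'" "is_inverse_op C C'"
    using assms unfolding boundedly_invertible_def by blast
  have "(C' o\<^sub>L B') o\<^sub>L (B o\<^sub>L C) = C' o\<^sub>L (B' o\<^sub>L B) o\<^sub>L C"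
    "(B o\<^sub>L C) o\<^sub>L (C' o\<^sub>L B') = B o\<^sub>L (C o\<^sub>L C') o\<^sub>L B'"
    by (simp_all only: blinfun_compose_assoc)
  then show ?thesis
    using inv by (intro boundedly_invertibleI[of "C' o\<^sub>L B'" _ "C' o\<^sub>L B'"])
      (simp_all add: is_inverse_op_def)
qed

text \<open>If \<open>D\<close> inverts the product, then \<open>D o\<^sub>L C\<close> is a left
  inverse of \<open>B\<close> because the factors commute, and \<open>C o\<^sub>L D\<close> is a
  right inverse.\<close>

lemma boundedly_invertible_compose_commute:
  assumes "boundedly_invertible (B o\<^sub>L C)" "B o\<^sub>L C = C o\<^sub>L B"
  shows "boundedly_invertible B"
proof -
  obtain D where "is_inverse_op (B o\<^sub>L C) D"
    using assms unfolding boundedly_invertible_def by blast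
  then have "(D o\<^sub>L C) o\<^sub>L B = id_blinfun" "B o\<^sub>L (C o\<^sub>L D) = id_blinfun"
    using assms(2) by (metis blinfun_compose_assoc is_inverse_op_def)+
  then show ?thesis
    by (rule boundedly_invertibleI)
qed

lemma boundedly_invertible_scaleR:
  assumes "boundedly_invertible B" "r \<noteq> 0"
  shows "boundedly_invertible (r *\<^sub>R B)"
proof -
  obtain C where "is_inverse_op B C"
    using assms unfolding boundedly_invertible_def by blast
  then show ?thesis
    using assms(2) by (intro boundedly_invertibleI[of "inverse r *\<^sub>R C" _ "inverse r *\<^sub>R C"])
      (simp_all add: is_inverse_op_def blinfun_compose_bilinear)
qed

lemma is_inverse_op_inverse_op:
  assumes "boundedly_invertible B"
  shows "is_inverse_op B (inverse_op B)"
proof -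
  have "\<exists>!C. is_inverse_op B C"
  proof (rule ex_ex1I)
    show "\<exists>C. is_inverse_op B C"
      using assms by (simp add: boundedly_invertible_def)
    show "C = D" if "is_inverse_op B C" "is_inverse_op B D" for C D
      using that by (metis blinfun_compose_assoc blinfun_compose_id is_inverse_op_def)
  qed
  then show ?thesis
    unfolding inverse_op_def by (rule theI')
qed

section \<open>Powers, the Neumann series and openness of invertibility\<close>

lemma power_op_0 [simp]: "power_op B 0 = id_blinfun"
  by (simp add: power_op_def)

lemma power_op_Suc [simp]: "power_op B (Suc n) = B o\<^sub>L power_op B n"
  by (simp add: power_op_def)

lemma power_op_compose_commute:
  "B o\<^sub>L C = C o\<^sub>L B \<Longrightarrow> power_op B n o\<^sub>L C = C o\<^sub>L power_op B n"
  by (induction n) (simp_all add: blinfun_compose_assoc, simp flip: blinfun_compose_assoc)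

lemma power_op_double: "power_op B (2 * n) = power_op (B o\<^sub>L B) n"
  by (induction n) (simp_all add: blinfun_compose_assoc)

lemma norm_power_op_le: "norm (power_op B n) \<le> norm B ^ n"
proof (induction n)
  case (Suc n)
  have "norm (power_op B (Suc n)) \<le> norm B * norm (power_op B n)"
    by (simp add: norm_blinfun_compose)
  also have "\<dots> \<le> norm B * norm B ^ n"
    using Suc by (simp add: mult_left_mono)
  finally show ?case by simp
qed (simp add: norm_blinfun_id_le)

text \<open>The Neumann series \<open>S\<close> of the powers of \<open>T\<close> converges by
  completeness. Splitting off its first term gives S = 1 + T S = 1 + S T.\<close>

lemma boundedly_invertible_id_minus:
  fixes T :: "'a::banach \<Rightarrow>\<^sub>L 'a"
  assumes "norm T < 1"
  shows "boundedly_invertible (id_blinfun - T)"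
proof -
  have sm: "summable (power_op T)"
    using assms by (intro summable_comparison_test'[OF summable_geometric norm_power_op_le]) auto
  define S where "S = suminf (power_op T)"
  have "S = id_blinfun + (\<Sum>n. power_op T (Suc n))"
    using suminf_split_head[OF sm] by (simp add: S_def)
  then have "S = id_blinfun + (\<Sum>n. T o\<^sub>L power_op T n)"
    by simp
  moreover have "(\<Sum>n. T o\<^sub>L power_op T n) = T o\<^sub>L S"
    unfolding S_def by (rule bounded_linear.suminf[OF _ sm, symmetric])
      (rule bounded_bilinear.bounded_linear_right[OF bounded_bilinear_blinfun_compose])
  moreover have "(\<Sum>n. power_op T n o\<^sub>L T) = S o\<^sub>L T"
    unfolding S_def by (rule bounded_linear.suminf[OF _ sm, symmetric])
      (rule bounded_bilinear.bounded_linear_left[OF bounded_bilinear_blinfun_compose])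
  ultimately have "S = id_blinfun + (T o\<^sub>L S)" "S = id_blinfun + (S o\<^sub>L T)"
    by (simp_all add: power_op_compose_commute)
  then show ?thesis
    by (intro boundedly_invertibleI[of S _ S]) (simp_all add: blinfun_compose_bilinear algebra_simps)
qed

text \<open>With \<open>C\<close> inverse to \<open>B\<close>, C B' = 1 - C (B - B') is a small
  perturbation of the identity, and B' = B (C B'). The summand 1 in the radius covers
  \<open>C = 0\<close>, possible on the trivial space.\<close>

lemma open_boundedly_invertible:
  "open {B :: 'a::banach \<Rightarrow>\<^sub>L 'a. boundedly_invertible B}"
proof (rule openI)
  fix B :: "'a \<Rightarrow>\<^sub>L 'a"
  assume "B \<in> {B. boundedly_invertible B}"
  then obtain C where C: "is_inverse_op B C"
    by (auto simp: boundedly_invertible_def)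
  have "boundedly_invertible B'" if "dist B B' < 1 / (norm C + 1)" for B'
  proof -
    have "norm (C o\<^sub>L (B - B')) \<le> norm C * norm (B - B')"
      by (rule norm_blinfun_compose)
    also have "\<dots> \<le> norm C * (1 / (norm C + 1))"
      using that by (intro mult_left_mono) (simp_all add: dist_norm)
    also have "\<dots> < 1"
      by (simp add: field_simps add_pos_nonneg)
    finally have "boundedly_invertible (id_blinfun - (C o\<^sub>L (B - B')))"
      by (rule boundedly_invertible_id_minus)
    then have "boundedly_invertible (C o\<^sub>L B')"
      using C by (simp add: is_inverse_op_def blinfun_compose_bilinear)
    moreover have "boundedly_invertible B"
      using C by (auto simp: boundedly_invertible_def)
    ultimately have "boundedly_invertible (B o\<^sub>L (C o\<^sub>L B'))"
      using boundedly_invertible_compose by blast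
    then show ?thesis
      using C by (simp add: is_inverse_op_def flip: blinfun_compose_assoc)
  qed
  then show "\<exists>e>0. ball B e \<subseteq> {B. boundedly_invertible B}"
    by (intro exI[of _ "1 / (norm C + 1)"]) (auto simp: add_nonneg_pos)
qed

lemma not_boundedly_invertible_LIMSEQ:
  fixes X :: "nat \<Rightarrow> 'a::banach \<Rightarrow>\<^sub>L 'a"
  assumes "X \<longlonglongrightarrow> B" "\<And>n. \<not> boundedly_invertible (X n)"
  shows "\<not> boundedly_invertible B"
proof
  assume "boundedly_invertible B"
  then have "eventually (\<lambda>n. X n \<in> {B. boundedly_invertible B}) sequentially"
    using topological_tendstoD[OF assms(1) open_boundedly_invertible] by simp
  then show False
    using assms(2) by (auto simp: eventually_sequentially)
qed

section \<open>Scalars and antilinear operators\<close>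

lemma scalar_op_apply [simp]: "scalar_op c x = c *\<^sub>C x"
  by (simp add: scalar_op.rep_eq)

lemma scalar_op_add: "scalar_op (a + b) = scalar_op a + scalar_op b"
  by (rule blinfun_eqI) (simp add: blinfun.bilinear_simps scaleC_add_left)

lemma scalar_op_mult: "scalar_op (a * b) = scalar_op a o\<^sub>L scalar_op b"
  by (rule blinfun_eqI) (simp add: scaleC_scaleC)

lemma scalar_op_of_real: "scalar_op (complex_of_real r) = r *\<^sub>R id_blinfun"
  by (rule blinfun_eqI) (simp add: blinfun.bilinear_simps scaleR_scaleC)

lemma scalar_op_0 [simp]: "scalar_op 0 = 0"
  using scalar_op_of_real[of 0] by simp

lemma scalar_op_1 [simp]: "scalar_op 1 = id_blinfun"
  using scalar_op_of_real[of 1] by simp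

lemma scalar_op_minus: "scalar_op (- a) = - scalar_op a"
  using scalar_op_add[of a "- a"] by (simp add: eq_neg_iff_add_eq_0 add.commute)

lemma boundedly_invertible_scalar_op:
  "a \<noteq> 0 \<Longrightarrow> boundedly_invertible (scalar_op a :: 'a::chilbert_space \<Rightarrow>\<^sub>L 'a)"
  by (rule boundedly_invertibleI[of "scalar_op (inverse a)" _ "scalar_op (inverse a)"])
    (simp_all flip: scalar_op_mult)

lemma bounded_linear_scalar_op:
  "bounded_linear (scalar_op :: complex \<Rightarrow> 'a::chilbert_space \<Rightarrow>\<^sub>L 'a)"
proof (rule bounded_linear_intro[where K = 1])
  show "scalar_op (r *\<^sub>R a) = r *\<^sub>R (scalar_op a :: 'a \<Rightarrow>\<^sub>L 'a)" for r a
    by (simp add: scaleR_conv_of_real scalar_op_mult scalar_op_of_real blinfun_compose_bilinear)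
  show "norm (scalar_op a :: 'a \<Rightarrow>\<^sub>L 'a) \<le> norm a * 1" for a
    by (rule norm_blinfun_bound) (simp_all add: norm_scaleC)
qed (rule scalar_op_add)

lemma tendsto_scalar_op:
  "(f \<longlongrightarrow> c) F \<Longrightarrow> ((\<lambda>x. scalar_op (f x)) \<longlongrightarrow> scalar_op c) F"
  by (rule bounded_linear.tendsto[OF bounded_linear_scalar_op])

text \<open>Non-invertible operators form a closed set. Both halves of the theorem pass to the limit
  here, with the point and the operator varying together.\<close>

lemma spectrum_LIMSEQ:
  fixes T :: "nat \<Rightarrow> 'a::chilbert_space \<Rightarrow>\<^sub>L 'a"
  assumes "c \<longlonglongrightarrow> c'" "T \<longlonglongrightarrow> T'" "\<And>n. c n \<in> spectrum (T n)"
  shows "c' \<in> spectrum T'"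
proof -
  have "(\<lambda>n. scalar_op (c n) - T n) \<longlonglongrightarrow> scalar_op c' - T'"
    using assms by (intro tendsto_diff tendsto_scalar_op)
  then show ?thesis
    using assms(3) not_boundedly_invertible_LIMSEQ by (auto simp: spectrum_def)
qed

lemma closed_spectrum: "closed (spectrum B)"
  unfolding closed_sequential_limits by (metis spectrum_LIMSEQ tendsto_const)

text \<open>For |z| > ||B|| the factorization z - B = z (1 - B / z) reduces to the Neumann
  series.\<close>

lemma spectrum_bound:
  assumes "z \<in> spectrum B"
  shows "cmod z \<le> norm B"
proof (rule ccontr)
  assume less: "\<not> cmod z \<le> norm B"
  then have z: "z \<noteq> 0"
    using norm_ge_zero[of B] by (metis norm_zero)
  define T where "T = scalar_op (inverse z) o\<^sub>L B"
  have "norm T \<le> inverse (cmod z) * norm B"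
    by (rule norm_blinfun_bound)
      (simp_all add: T_def norm_scaleC norm_inverse mult_left_mono norm_blinfun mult.assoc)
  also have "\<dots> < 1"
    using less z by (simp add: field_simps)
  finally have "boundedly_invertible (scalar_op z o\<^sub>L (id_blinfun - T))"
    using z by (intro boundedly_invertible_compose boundedly_invertible_scalar_op
        boundedly_invertible_id_minus)
  moreover have "scalar_op z o\<^sub>L (id_blinfun - T) = scalar_op z - B"
    using z by (simp add: T_def blinfun_compose_bilinear flip: blinfun_compose_assoc scalar_op_mult)
  ultimately show False
    using assms by (simp add: spectrum_def)
qed

lemma compact_spectrum: "compact (spectrum B)"
  using closed_spectrum spectrum_bound
  by (auto simp: compact_eq_bounded_closed bounded_iff)

section \<open>Complex linear and antilinear operators\<close>

definition complex_linear_op :: "('a::chilbert_space \<Rightarrow>\<^sub>L 'a) \<Rightarrow> bool" where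
  "complex_linear_op B \<longleftrightarrow> (\<forall>c. B o\<^sub>L scalar_op c = scalar_op c o\<^sub>L B)"

lemma complex_linear_op_commute:
  "complex_linear_op B \<Longrightarrow> B o\<^sub>L scalar_op c = scalar_op c o\<^sub>L B"
  by (simp add: complex_linear_op_def)

lemma antilinear_commute:
  "antilinear A \<Longrightarrow> A o\<^sub>L scalar_op c = scalar_op (cnj c) o\<^sub>L A"
  by (simp add: antilinear_def)

lemma complex_linear_op_antilinear_square:
  assumes "antilinear A"
  shows "complex_linear_op (A o\<^sub>L A)"
  unfolding complex_linear_op_def
  by (metis antilinear_commute[OF assms] blinfun_compose_assoc complex_cnj_cnj)

text \<open>The mixed terms cancel: A (cnj z) = z A in the first product and A z = (cnj z) A in the
  second.\<close>

lemma antilinear_factor: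
  assumes "antilinear A"
  shows "(scalar_op z - A) o\<^sub>L (scalar_op (cnj z) + A) = (cmod z)\<^sup>2 *\<^sub>R id_blinfun - (A o\<^sub>L A)"
    and "(scalar_op (cnj z) + A) o\<^sub>L (scalar_op z - A) = (cmod z)\<^sup>2 *\<^sub>R id_blinfun - (A o\<^sub>L A)"
proof -
  have z: "scalar_op z o\<^sub>L scalar_op (cnj z) = (cmod z)\<^sup>2 *\<^sub>R id_blinfun"
    "scalar_op (cnj z) o\<^sub>L scalar_op z = (cmod z)\<^sup>2 *\<^sub>R id_blinfun"
    by (simp_all only: complex_norm_square mult.commute flip: scalar_op_mult scalar_op_of_real)
  show "(scalar_op z - A) o\<^sub>L (scalar_op (cnj z) + A) = (cmod z)\<^sup>2 *\<^sub>R id_blinfun - (A o\<^sub>L A)"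
    "(scalar_op (cnj z) + A) o\<^sub>L (scalar_op z - A) = (cmod z)\<^sup>2 *\<^sub>R id_blinfun - (A o\<^sub>L A)"
    using antilinear_commute[OF assms, of "cnj z"] antilinear_commute[OF assms, of z]
    by (simp_all add: blinfun_compose_bilinear z)
qed

lemma spectrum_antilinear_square:
  assumes "antilinear A" "z \<in> spectrum A"
  shows "complex_of_real ((cmod z)\<^sup>2) \<in> spectrum (A o\<^sub>L A)"
  using assms(2) boundedly_invertible_compose_commute[of "scalar_op z - A" "scalar_op (cnj z) + A"]
  unfolding spectrum_def mem_Collect_eq scalar_op_of_real antilinear_factor[OF assms(1)] by blast

lemma antilinear_scalar_shift:
  assumes "antilinear A" "s * z = w * cnj s"
  shows "scalar_op s o\<^sub>L (scalar_op z - A) = (scalar_op w - A) o\<^sub>L scalar_op (cnj s)"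
  using assms by (simp add: blinfun_compose_bilinear antilinear_commute flip: scalar_op_mult)

section \<open>Operators congruent to a scalar\<close>

text \<open>This is congruence of \<open>F\<close> to the scalar \<open>c\<close> modulo t - B
  inside the commutant of \<open>B\<close>, modelled on u(t) - u(B) = P (t - B) for polynomials u.
  Since \<open>P\<close> commutes with \<open>B\<close>, the factor t - B can be put on either
  side.\<close>

definition cong_scalar ::
    "real \<Rightarrow> ('a::chilbert_space \<Rightarrow>\<^sub>L 'a) \<Rightarrow> complex \<Rightarrow> ('a \<Rightarrow>\<^sub>L 'a) \<Rightarrow> bool" where
  "cong_scalar t B c F \<longleftrightarrow> F o\<^sub>L B = B o\<^sub>L F \<and>
     (\<exists>P. P o\<^sub>L B = B o\<^sub>L P \<and> scalar_op c - F = P o\<^sub>L (t *\<^sub>R id_blinfun - B))"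

lemma cong_scalar_self: "cong_scalar t B (complex_of_real t) B"
  unfolding cong_scalar_def by (intro conjI exI[of _ id_blinfun]) (simp_all add: scalar_op_of_real)

lemma cong_scalar_scalar: "complex_linear_op B \<Longrightarrow> cong_scalar t B c (scalar_op c)"
  unfolding cong_scalar_def by (intro conjI exI[of _ 0]) (simp_all add: complex_linear_op_commute)

lemma cong_scalar_add:
  assumes "cong_scalar t B c F" "cong_scalar t B d G"
  shows "cong_scalar t B (c + d) (F + G)"
proof -
  obtain P Q where
    "P o\<^sub>L B = B o\<^sub>L P" "scalar_op c - F = P o\<^sub>L (t *\<^sub>R id_blinfun - B)"
    "Q o\<^sub>L B = B o\<^sub>L Q" "scalar_op d - G = Q o\<^sub>L (t *\<^sub>R id_blinfun - B)"
    using assms unfolding cong_scalar_def by blast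
  moreover have "scalar_op (c + d) - (F + G) = (scalar_op c - F) + (scalar_op d - G)"
    by (simp add: scalar_op_add)
  ultimately show ?thesis
    using assms unfolding cong_scalar_def
    by (intro conjI exI[of _ "P + Q"]) (simp_all add: blinfun_compose_bilinear scaleR_add_right)
qed

text \<open>Telescoping: c d - F G = c (d - G) + (c - F) G, after which t - B is moved to the right
  past \<open>G\<close>.\<close>

lemma cong_scalar_compose:
  assumes "complex_linear_op B" "cong_scalar t B c F" "cong_scalar t B d G"
  shows "cong_scalar t B (c * d) (F o\<^sub>L G)"
proof -
  let ?M = "t *\<^sub>R id_blinfun - B"
  obtain P Q where P: "P o\<^sub>L B = B o\<^sub>L P" "scalar_op c - F = P o\<^sub>L ?M"
    and Q: "Q o\<^sub>L B = B o\<^sub>L Q" "scalar_op d - G = Q o\<^sub>L ?M"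
    using assms unfolding cong_scalar_def by blast
  have comm: "F o\<^sub>L B = B o\<^sub>L F" "G o\<^sub>L B = B o\<^sub>L G"
    using assms unfolding cong_scalar_def by blast+
  have commute: "(X o\<^sub>L Y) o\<^sub>L B = B o\<^sub>L (X o\<^sub>L Y)"
    if "X o\<^sub>L B = B o\<^sub>L X" "Y o\<^sub>L B = B o\<^sub>L Y" for X Y
    using that by (metis blinfun_compose_assoc)
  have "scalar_op (c * d) - (F o\<^sub>L G)
      = (scalar_op c o\<^sub>L (scalar_op d - G)) + ((scalar_op c - F) o\<^sub>L G)"
    by (simp add: blinfun_compose_bilinear scalar_op_mult)
  also have "\<dots> = (scalar_op c o\<^sub>L (Q o\<^sub>L ?M)) + (P o\<^sub>L (?M o\<^sub>L G))"
    by (simp only: P Q blinfun_compose_assoc)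
  also have "?M o\<^sub>L G = G o\<^sub>L ?M"
    by (simp add: blinfun_compose_bilinear comm)
  finally have "scalar_op (c * d) - (F o\<^sub>L G) = ((scalar_op c o\<^sub>L Q) + (P o\<^sub>L G)) o\<^sub>L ?M"
    by (simp add: blinfun_compose_bilinear blinfun_compose_assoc scaleR_add_right)
  moreover have "((scalar_op c o\<^sub>L Q) + (P o\<^sub>L G)) o\<^sub>L B = B o\<^sub>L ((scalar_op c o\<^sub>L Q) + (P o\<^sub>L G))"
    using commute[of "scalar_op c" Q] commute[of P G] complex_linear_op_commute[OF assms(1), of c]
      P Q comm by (simp add: blinfun_compose_bilinear(1,2))
  ultimately show ?thesis
    using commute[OF comm] unfolding cong_scalar_def by blast
qed

lemma cong_scalar_power:
  assumes "complex_linear_op B" "cong_scalar t B c F"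
  shows "cong_scalar t B (c ^ n) (power_op F n)"
proof (induction n)
  case 0
  then show ?case using cong_scalar_scalar[OF assms(1), of t 1] by simp
next
  case (Suc n)
  then show ?case using cong_scalar_compose[OF assms] by simp
qed

text \<open>The multiplier comes from 1/t - C = -(1/t) C (t - B). Negative powers of A^2 are reached
  this way.\<close>

lemma cong_scalar_inverse:
  assumes "is_inverse_op B C" "t \<noteq> 0"
  shows "cong_scalar t B (inverse (complex_of_real t)) C"
proof -
  have "scalar_op (inverse (complex_of_real t)) - C
      = (- inverse t *\<^sub>R C) o\<^sub>L (t *\<^sub>R id_blinfun - B)"
    using assms by (simp add: is_inverse_op_def blinfun_compose_bilinear scalar_op_of_real
        flip: of_real_inverse)
  then show ?thesis
    using assms unfolding cong_scalar_def
    by (intro conjI exI[of _ "- inverse t *\<^sub>R C"])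
      (simp_all add: is_inverse_op_def blinfun_compose_bilinear)
qed

lemma cong_scalar_sum:
  assumes "complex_linear_op B" "\<And>i. i \<in> I \<Longrightarrow> cong_scalar t B (c i) (F i)"
  shows "cong_scalar t B (sum c I) (sum F I)"
  using assms(2)
proof (induction I rule: infinite_finite_induct)
  case (insert i I)
  then show ?case by (simp add: cong_scalar_add)
qed (use cong_scalar_scalar[OF assms(1), of t 0] in simp_all)

lemma cong_scalar_poly:
  assumes "complex_linear_op B"
  shows "cong_scalar t B (poly p (complex_of_real t)) (poly_op p B)"
  unfolding poly_altdef poly_op_def
  by (intro cong_scalar_sum cong_scalar_compose cong_scalar_scalar cong_scalar_power
      cong_scalar_self assms)

text \<open>
  With \<open>M = |z|\<^sup>2 - A\<^sup>2 = (z - A) (cnj z + A) = (cnj z + A) (z - A)\<close> the difference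
  \<open>u + v z - (F + G A) = (u - F) + v (z - A) + (v - G) A\<close> is a left multiple of \<open>z - A\<close>. As
  \<open>v (z - A) = (w - A) cnj v\<close> for some \<open>w\<close> with \<open>|w| = |z|\<close>, it is also a right multiple of
  \<open>w - A\<close>, and \<open>w - A = s (z - A) s\<close> for a unimodular scalar \<open>s\<close>. So if the difference is
  invertible, then \<open>z - A\<close> has a left and a right inverse.
\<close>

lemma spectrum_antilinear_cong_scalar:
  fixes A :: "'a::chilbert_space \<Rightarrow>\<^sub>L 'a"
  assumes A: "antilinear A" and z: "z \<in> spectrum A"
    and F: "cong_scalar ((cmod z)\<^sup>2) (A o\<^sub>L A) u F"
    and G: "cong_scalar ((cmod z)\<^sup>2) (A o\<^sub>L A) v G"
  shows "u + v * z \<in> spectrum (F + (G o\<^sub>L A))"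
proof (rule ccontr)
  let ?D = "scalar_op (u + v * z) - (F + (G o\<^sub>L A))"
  let ?M = "(cmod z)\<^sup>2 *\<^sub>R id_blinfun - (A o\<^sub>L A)"
  assume "u + v * z \<notin> spectrum (F + (G o\<^sub>L A))"
  then obtain E where E: "is_inverse_op ?D E"
    by (auto simp: spectrum_def boundedly_invertible_def)
  obtain P Q where P: "P o\<^sub>L (A o\<^sub>L A) = (A o\<^sub>L A) o\<^sub>L P" "scalar_op u - F = P o\<^sub>L ?M"
    and Q: "Q o\<^sub>L (A o\<^sub>L A) = (A o\<^sub>L A) o\<^sub>L Q" "scalar_op v - G = Q o\<^sub>L ?M"
    using F G unfolding cong_scalar_def by blast
  \<comment> \<open>One multiplier for both differences: \<open>A\<close> commutes with
    \<open>?M\<close>, so (u - F) + (v - G) A = R M.\<close>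
  define R where "R = P + (Q o\<^sub>L A)"
  have MA: "?M o\<^sub>L A = A o\<^sub>L ?M"
    by (simp add: blinfun_compose_bilinear blinfun_compose_assoc)
  have MP: "P o\<^sub>L ?M = ?M o\<^sub>L P" "Q o\<^sub>L ?M = ?M o\<^sub>L Q"
    using P Q by (simp_all add: blinfun_compose_bilinear)
  have D: "?D = (scalar_op u - F) + (scalar_op v o\<^sub>L (scalar_op z - A))
      + ((scalar_op v - G) o\<^sub>L A)"
    by (simp add: blinfun_compose_bilinear scalar_op_add scalar_op_mult)
  have left: "R o\<^sub>L ?M = (scalar_op u - F) + ((scalar_op v - G) o\<^sub>L A)"
    unfolding R_def P(2) Q(2) blinfun_compose_bilinear(1) blinfun_compose_assoc[of Q] MA ..
  have right: "?M o\<^sub>L R = R o\<^sub>L ?M"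
    unfolding R_def blinfun_compose_bilinear(1,2) MP blinfun_compose_assoc[of Q] MA[symmetric]
    by (simp only: MP flip: blinfun_compose_assoc)
  have "?D = (R o\<^sub>L ?M) + (scalar_op v o\<^sub>L (scalar_op z - A))"
    unfolding D left by simp
  also have "\<dots> = ((R o\<^sub>L (scalar_op (cnj z) + A)) + scalar_op v) o\<^sub>L (scalar_op z - A)"
    unfolding blinfun_compose_bilinear(1)[of _ "scalar_op v"] blinfun_compose_assoc
      antilinear_factor(2)[OF A] ..
  finally have "(E o\<^sub>L ((R o\<^sub>L (scalar_op (cnj z) + A)) + scalar_op v)) o\<^sub>L (scalar_op z - A)
      = id_blinfun"
    using E by (simp add: is_inverse_op_def blinfun_compose_assoc)
  note left_inverse = this
  \<comment> \<open>A square root of the phase of \<open>v / cnj v\<close> turns v z into s^2 z (cnj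
    v). For \<open>v = 0\<close> any unimodular number would serve.\<close>
  define s where "s = (if v = 0 then 1 else csqrt (v / cnj v))"
  have s: "cmod s = 1" "v * z = (s * s * z) * cnj v"
    by (simp_all add: s_def norm_divide flip: power2_eq_square)
  define w where "w = s * s * z"
  have cmod_w: "cmod w = cmod z"
    by (simp add: w_def norm_mult s)
  have "?D = (?M o\<^sub>L R) + ((scalar_op w - A) o\<^sub>L scalar_op (cnj v))"
    using antilinear_scalar_shift[OF A s(2)] unfolding D right left w_def by simp
  also have "\<dots> = (scalar_op w - A) o\<^sub>L (((scalar_op (cnj w) + A) o\<^sub>L R) + scalar_op (cnj v))"
    using antilinear_factor(1)[OF A, of w]
    by (simp only: blinfun_compose_bilinear(2) cmod_w flip: blinfun_compose_assoc)
  finally obtain S where S: "(scalar_op w - A) o\<^sub>L S = id_blinfun"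
    using E by (metis is_inverse_op_def blinfun_compose_assoc)
  have ss: "s * cnj s = 1"
    using s(1) by (metis complex_norm_square of_real_1 one_power2)
  \<comment> \<open>Rotating back turns the right inverse of w - A into one of z - A: first (z - A)
    s S = cnj s, then multiplication by \<open>s\<close> from the right.\<close>
  have "cnj s * w = z * cnj (cnj s)"
    using ss by (simp add: w_def mult_ac)
  then have "scalar_op (cnj s) o\<^sub>L (scalar_op w - A) = (scalar_op z - A) o\<^sub>L scalar_op s"
    using antilinear_scalar_shift[OF A, of "cnj s" w z] by simp
  then have "(scalar_op z - A) o\<^sub>L (scalar_op s o\<^sub>L S) = scalar_op (cnj s)"
    using S by (metis blinfun_compose_assoc blinfun_compose_id(1))
  then have "(scalar_op z - A) o\<^sub>L (scalar_op s o\<^sub>L S o\<^sub>L scalar_op s) = id_blinfun"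
    using ss by (metis blinfun_compose_assoc mult.commute scalar_op_1 scalar_op_mult)
  with left_inverse have "boundedly_invertible (scalar_op z - A)"
    by (rule boundedly_invertibleI)
  then show False
    using z by (simp add: spectrum_def)
qed

section \<open>Laurent series\<close>

text \<open>The half-open window contains exactly \<open>N\<close> nonnegative and \<open>N\<close>
  negative indices, since the negative half starts at -1.\<close>

lemma bi_suminf_LIMSEQ:
  assumes "bi_summable g"
  shows "(\<lambda>N. sum g {- int N..<int N}) \<longlonglongrightarrow> bi_suminf g"
proof -
  have "sum g {- int N..<int N} = (\<Sum>n<N. g (int n)) + (\<Sum>n<N. g (- int (Suc n)))" for N
  proof (induction N)
    case (Suc N)
    have "{- int (Suc N)..<int (Suc N)} = insert (- int (Suc N)) (insert (int N) {- int N..<int N})"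
      by auto
    then show ?case using Suc by (simp add: algebra_simps)
  qed simp
  moreover have "(\<lambda>N. \<Sum>n<N. g (int n)) \<longlonglongrightarrow> (\<Sum>n. g (int n))"
    "(\<lambda>N. \<Sum>n<N. g (- int (Suc n))) \<longlonglongrightarrow> (\<Sum>n. g (- int (Suc n)))"
    using assms unfolding bi_summable_def by (auto intro: summable_LIMSEQ)
  ultimately show ?thesis
    unfolding bi_suminf_def by (auto intro: tendsto_add)
qed

text \<open>The operator series need not converge absolutely, so its even and odd parts cannot
  simply be separated; grouping neighbours is always allowed. No pair straddles zero: k = -(n+1)
  pairs -(2n+2) with -(2n+1).\<close>

lemma bi_sum_group_pairs:
  assumes "bi_summable g"
  shows "bi_summable (\<lambda>k. g (2 * k) + g (2 * k + 1))"
    and "bi_suminf (\<lambda>k. g (2 * k) + g (2 * k + 1)) = bi_suminf g"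
proof -
  have pairs: "(\<lambda>n. f (2 * n) + f (2 * n + 1)) sums suminf f" if "summable f" for f :: "nat \<Rightarrow> 'a"
    using sums_group[OF summable_sums[OF that], of 2] by (simp add: mult.commute)
  have "(\<lambda>n. g (2 * int n) + g (2 * int n + 1)) sums (\<Sum>n. g (int n))"
    using pairs[of "\<lambda>n. g (int n)"] assms by (simp add: bi_summable_def add.commute)
  moreover have "(\<lambda>n. g (2 * (- int (Suc n))) + g (2 * (- int (Suc n)) + 1))
      sums (\<Sum>n. g (- int (Suc n)))"
    using pairs[of "\<lambda>n. g (- int (Suc n))"] assms
    by (simp add: bi_summable_def algebra_simps)
  ultimately show "bi_summable (\<lambda>k. g (2 * k) + g (2 * k + 1))"
    and "bi_suminf (\<lambda>k. g (2 * k) + g (2 * k + 1)) = bi_suminf g"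
    unfolding bi_summable_def bi_suminf_def by (simp_all add: sums_iff)
qed

lemma bi_summable_add:
  "bi_summable f \<Longrightarrow> bi_summable g \<Longrightarrow> bi_summable (\<lambda>k. f k + g k)"
  unfolding bi_summable_def by (auto intro: summable_add)

lemma bi_summable_mult:
  "bi_summable f \<Longrightarrow> bi_summable (\<lambda>k. c * f k)" for c :: "'b::real_normed_algebra"
  unfolding bi_summable_def by (auto intro: summable_mult)

lemma laurent_region_circular:
  "laurent_region \<alpha> D \<Longrightarrow> z \<in> D \<Longrightarrow> cmod w = cmod z \<Longrightarrow> w \<in> D"
  unfolding laurent_region_def by auto

text \<open>
  At the points \<open>|z|\<close> and \<open>-|z|\<close> the pairs of consecutive terms of the Laurent series are the sum
  and the difference of the two halves of the series for \<open>laurent_hat\<close>.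
\<close>

lemma bi_summable_laurent_hat:
  assumes "laurent_region \<alpha> D" "laurent_converges_on \<alpha> D" "z \<in> D"
  shows "bi_summable
    (\<lambda>k. (\<alpha> (2 * k) + \<alpha> (2 * k + 1) * z) * complex_of_real (cmod z powi (2 * k)))"
proof -
  define r where "r = complex_of_real (cmod z)"
  have "r \<in> D" "- r \<in> D"
    using assms by (auto intro: laurent_region_circular simp: r_def)
  define g where "g w k = \<alpha> (2 * k) * w powi (2 * k) + \<alpha> (2 * k + 1) * w powi (2 * k + 1)" for w k
  have "bi_summable (g w)" if "w \<in> D" for w
    using assms(2) that bi_sum_group_pairs(1)[of "\<lambda>k. \<alpha> k * w powi k"]
    unfolding laurent_converges_on_def g_def by simp
  with \<open>r \<in> D\<close> \<open>- r \<in> D\<close> have "bi_summable (\<lambda>k. (1 / 2 + z / (2 * r)) * g r k + (1 / 2 - z / (2 * r)) * g (- r) k)"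
    by (intro bi_summable_add bi_summable_mult)
  moreover have "(1 / 2 + z / (2 * r)) * g r k + (1 / 2 - z / (2 * r)) * g (- r) k
      = (\<alpha> (2 * k) + \<alpha> (2 * k + 1) * z) * complex_of_real (cmod z powi (2 * k))" for k
  proof -
    \<comment> \<open>A nonzero total exponent keeps the exponent law valid at
      \<open>r = 0\<close>.\<close>
    have "2 * k + 1 \<noteq> 0"
      by presburger
    then have odd: "r powi (2 * k + 1) = r powi (2 * k) * r" "(- r) powi (2 * k + 1) = - (r powi (2 * k) * r)"
      using power_int_add[of r "2 * k" 1] by (simp_all add: power_int_minus_left)
    have even: "(- r) powi (2 * k) = r powi (2 * k)"
      by (simp add: power_int_minus_left)
    have "(1 / 2 + z / (2 * r)) * g r k + (1 / 2 - z / (2 * r)) * g (- r) k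
      = \<alpha> (2 * k) * r powi (2 * k) + \<alpha> (2 * k + 1) * r powi (2 * k) * (z * (r / r))"
      unfolding g_def odd even by (simp add: algebra_simps add_divide_distrib diff_divide_distrib)
    \<comment> \<open>If \<open>r = 0\<close>, then also \<open>z = 0\<close> and both sides
      vanish.\<close>
    also have "z * (r / r) = z"
      by (simp add: r_def)
    finally show ?thesis
      by (simp add: r_def algebra_simps of_real_power_int)
  qed
  ultimately show ?thesis by simp
qed

text \<open>Even powers of \<open>A\<close> are powers of A^2, which is complex linear. For negative
  \<open>k\<close>, invertibility of \<open>A\<close> excludes \<open>z = 0\<close>, so |z|^2 may be
  inverted.\<close>

lemma power_int_op_pair:
  assumes A: "antilinear A" and z: "z \<in> spectrum A" and inv: "k < 0 \<Longrightarrow> boundedly_invertible A"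
  shows "cong_scalar ((cmod z)\<^sup>2) (A o\<^sub>L A) (complex_of_real (cmod z powi (2 * k)))
      (power_int_op A (2 * k))" (is ?cong)
    and "power_int_op A (2 * k + 1) = power_int_op A (2 * k) o\<^sub>L A" (is ?odd)
proof -
  note lin = complex_linear_op_antilinear_square[OF A]
  have "?cong \<and> ?odd"
  proof (cases k)
    case (nonneg n)
    have "nat (2 * int n) = 2 * n" "nat (2 * int n + 1) = Suc (2 * n)"
      by auto
    moreover have "cong_scalar ((cmod z)\<^sup>2) (A o\<^sub>L A) (complex_of_real ((cmod z)\<^sup>2) ^ n)
        (power_op (A o\<^sub>L A) n)"
      by (intro cong_scalar_power cong_scalar_self lin)
    moreover have "complex_of_real ((cmod z)\<^sup>2) ^ n = complex_of_real (cmod z powi (2 * int n))"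
      by (simp add: power_int_def nat_mult_distrib power_mult)
    ultimately show ?thesis
      using power_op_compose_commute[of A A "2 * n"]
      by (simp add: nonneg power_int_op_def power_op_double)
  next
    case (neg m)
    define C where "C = inverse_op A"
    have C: "A o\<^sub>L C = id_blinfun" "C o\<^sub>L A = id_blinfun"
      using is_inverse_op_inverse_op[OF inv] neg by (auto simp: C_def is_inverse_op_def)
    have "z \<noteq> 0"
    proof
      assume "z = 0"
      moreover have "boundedly_invertible (- A)"
        using boundedly_invertible_scaleR[OF inv, of "-1"] neg by simp
      ultimately show False
        using z by (simp add: spectrum_def)
    qed
    \<comment> \<open>Here k = -(m+1), so the even exponent gives 2m+2 factors \<open>C\<close> and
      the odd one 2m+1.\<close>
    have nat_eq: "nat (- (2 * k)) = Suc (Suc (2 * m))" "nat (- (2 * k + 1)) = Suc (2 * m)"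
      "\<not> 0 \<le> 2 * k" "\<not> 0 \<le> 2 * k + 1"
      using neg by auto
    have int_eq: "power_int_op A (2 * k) = power_op C (2 * Suc m)"
      "power_int_op A (2 * k + 1) = power_op C (Suc (2 * m))"
      unfolding power_int_op_def nat_eq C_def using nat_eq(3,4) by simp_all
    have "is_inverse_op (A o\<^sub>L A) (C o\<^sub>L C)"
      using C by (simp add: is_inverse_op_def) (metis blinfun_compose_assoc blinfun_compose_id(1))
    then have "cong_scalar ((cmod z)\<^sup>2) (A o\<^sub>L A) (inverse (complex_of_real ((cmod z)\<^sup>2)) ^ Suc m)
        (power_op (C o\<^sub>L C) (Suc m))"
      using \<open>z \<noteq> 0\<close> by (intro cong_scalar_power cong_scalar_inverse lin) simp_all
    moreover have "inverse (complex_of_real ((cmod z)\<^sup>2)) ^ Suc m = complex_of_real (cmod z powi (2 * k))"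
      unfolding power_int_def nat_eq using nat_eq(3)
      by (simp add: power_inverse power_mult power2_eq_square)
    moreover have "power_op C (2 * Suc m) o\<^sub>L A = power_op C (Suc (2 * m))"
    proof -
      have "power_op C (2 * Suc m) o\<^sub>L A = (power_op C (Suc (2 * m)) o\<^sub>L C) o\<^sub>L A"
        using power_op_compose_commute[of C C "Suc (2 * m)"] by simp
      then show ?thesis
        by (simp only: blinfun_compose_assoc C blinfun_compose_id)
    qed
    ultimately show ?thesis
      unfolding int_eq power_op_double by simp
  qed
  then show ?cong ?odd by auto
qed

lemma spectrum_laurent_sum:
  fixes A :: "'a::chilbert_space \<Rightarrow>\<^sub>L 'a"
  assumes A: "antilinear A" and z: "z \<in> spectrum A"
    and inv: "(\<exists>k<0. \<alpha> k \<noteq> 0) \<longrightarrow> boundedly_invertible A"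
  shows "(\<Sum>k\<in>K. (\<alpha> (2 * k) + \<alpha> (2 * k + 1) * z) * complex_of_real (cmod z powi (2 * k)))
    \<in> spectrum (\<Sum>k\<in>K. (scalar_op (\<alpha> (2 * k)) o\<^sub>L power_int_op A (2 * k))
        + (scalar_op (\<alpha> (2 * k + 1)) o\<^sub>L power_int_op A (2 * k + 1)))"
proof -
  let ?r = "\<lambda>k. complex_of_real (cmod z powi (2 * k))"
  let ?cong = "cong_scalar ((cmod z)\<^sup>2) (A o\<^sub>L A)"
  define F where "F j k = scalar_op (\<alpha> j) o\<^sub>L power_int_op A (2 * k)" for j k
  note lin = complex_linear_op_antilinear_square[OF A]
  \<comment> \<open>The sign condition holds for j = 2k and j = 2k+1. If \<open>A\<close> is not
    invertible and \<open>k < 0\<close>, it forces \<open>\<alpha> j = 0\<close>, so the unspecified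
    \<open>inverse_op A\<close> is multiplied by zero.\<close>
  have cong: "?cong (\<alpha> j * ?r k) (F j k)" if "j < 0 \<longleftrightarrow> k < 0" for j k
  proof (cases "k < 0 \<longrightarrow> boundedly_invertible A")
    case True
    then show ?thesis
      unfolding F_def
      by (intro cong_scalar_compose cong_scalar_scalar power_int_op_pair(1) A z lin) auto
  next
    case False
    then show ?thesis
      using inv that cong_scalar_scalar[OF lin, of "(cmod z)\<^sup>2" 0] by (auto simp: F_def)
  qed
  have odd: "scalar_op (\<alpha> (2 * k + 1)) o\<^sub>L power_int_op A (2 * k + 1) = F (2 * k + 1) k o\<^sub>L A" for k
  proof (cases "k < 0 \<longrightarrow> boundedly_invertible A")
    case True
    then show ?thesis
      using power_int_op_pair(2)[OF A z, of k] by (simp add: F_def blinfun_compose_assoc)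
  next
    case False
    then have "\<alpha> (2 * k + 1) = 0"
      using inv by auto
    then show ?thesis
      by (simp add: F_def)
  qed
  have "(\<Sum>k\<in>K. \<alpha> (2 * k) * ?r k) + (\<Sum>k\<in>K. \<alpha> (2 * k + 1) * ?r k) * z
      \<in> spectrum ((\<Sum>k\<in>K. F (2 * k) k) + ((\<Sum>k\<in>K. F (2 * k + 1) k) o\<^sub>L A))"
    by (intro spectrum_antilinear_cong_scalar[OF A z] cong_scalar_sum cong lin) auto
  also have "(\<Sum>k\<in>K. F (2 * k) k) + ((\<Sum>k\<in>K. F (2 * k + 1) k) o\<^sub>L A)
      = (\<Sum>k\<in>K. (scalar_op (\<alpha> (2 * k)) o\<^sub>L power_int_op A (2 * k))
        + (scalar_op (\<alpha> (2 * k + 1)) o\<^sub>L power_int_op A (2 * k + 1)))"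
    unfolding odd bounded_bilinear.sum_left[OF bounded_bilinear_blinfun_compose]
    by (simp add: F_def sum.distrib)
  also have "(\<Sum>k\<in>K. \<alpha> (2 * k) * ?r k) + (\<Sum>k\<in>K. \<alpha> (2 * k + 1) * ?r k) * z
      = (\<Sum>k\<in>K. (\<alpha> (2 * k) + \<alpha> (2 * k + 1) * z) * ?r k)"
    by (simp only: sum_distrib_right distrib_right sum.distrib) (simp add: mult_ac)
  finally show ?thesis .
qed

text \<open>Windows of paired terms approximate the scalar and the operator at once, and each finite
  stage is \<open>spectrum_laurent_sum\<close>.\<close>

lemma laurent_hat_spectrum:
  assumes A: "antilinear A" and z: "z \<in> spectrum A" and "spectrum A \<subseteq> D"
    and "laurent_region \<alpha> D" "laurent_converges_on \<alpha> D" "laurent_op_defined \<alpha> A"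
  shows "laurent_hat \<alpha> z \<in> spectrum (laurent_op \<alpha> A)"
proof (rule spectrum_LIMSEQ)
  let ?g = "\<lambda>k. scalar_op (\<alpha> k) o\<^sub>L power_int_op A k"
  let ?K = "\<lambda>N. {- int N..<int N}"
  have g: "bi_summable ?g" and inv: "(\<exists>k<0. \<alpha> k \<noteq> 0) \<longrightarrow> boundedly_invertible A"
    using assms by (auto simp: laurent_op_defined_def)
  show "(\<lambda>N. \<Sum>k\<in>?K N. (\<alpha> (2 * k) + \<alpha> (2 * k + 1) * z) * complex_of_real (cmod z powi (2 * k)))
      \<longlonglongrightarrow> laurent_hat \<alpha> z"
    unfolding laurent_hat_def using assms
    by (intro bi_suminf_LIMSEQ bi_summable_laurent_hat[of \<alpha> D]) auto
  show "(\<lambda>N. \<Sum>k\<in>?K N. ?g (2 * k) + ?g (2 * k + 1)) \<longlonglongrightarrow> laurent_op \<alpha> A"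
    using bi_suminf_LIMSEQ[OF bi_sum_group_pairs(1)[OF g]] bi_sum_group_pairs(2)[OF g]
    unfolding laurent_op_def by simp
  show "(\<Sum>k\<in>?K N. (\<alpha> (2 * k) + \<alpha> (2 * k + 1) * z) * complex_of_real (cmod z powi (2 * k)))
      \<in> spectrum (\<Sum>k\<in>?K N. ?g (2 * k) + ?g (2 * k + 1))" for N
    by (rule spectrum_laurent_sum[OF A z inv])
qed

section \<open>Continuous functional calculus\<close>

lemma is_adjoint_iff: "is_adjoint B C \<longleftrightarrow> (\<forall>x y. inner (B x) y = inner x (C y))"
  by (simp add: is_adjoint_def inner_eq_Re_cinner)

lemma is_adjointD: "is_adjoint B C \<Longrightarrow> inner (B x) y = inner x (C y)"
  by (simp add: is_adjoint_iff)

lemma is_adjoint_add: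
  "is_adjoint B C \<Longrightarrow> is_adjoint B' C' \<Longrightarrow> is_adjoint (B + B') (C + C')"
  by (simp add: is_adjoint_iff blinfun.bilinear_simps inner_add)

lemma is_adjoint_compose:
  "is_adjoint B C \<Longrightarrow> is_adjoint B' C' \<Longrightarrow> is_adjoint (B o\<^sub>L B') (C' o\<^sub>L C)"
  by (simp add: is_adjoint_iff)

lemma is_adjoint_scalar_op: "is_adjoint (scalar_op c) (scalar_op (cnj c))"
proof -
  have "cinner x (cnj c *\<^sub>C y) = c * cinner x y" for x y :: 'a
    by (metis cinner_commute cinner_scaleC_left complex_cnj_cnj complex_cnj_mult)
  then show ?thesis
    by (simp add: is_adjoint_def cinner_scaleC_left)
qed

lemma norm_square_diff_self_adjoint:
  assumes "self_adjoint S"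
  shows "(norm ((m\<^sup>2 *\<^sub>R id_blinfun - (S o\<^sub>L S)) x))\<^sup>2
    = m ^ 4 * (norm x)\<^sup>2 - 2 * m\<^sup>2 * (norm (S x))\<^sup>2 + (norm (S (S x)))\<^sup>2"
  using is_adjointD[OF assms[unfolded self_adjoint_def], of x "S x"]
  unfolding power2_norm_eq_inner
  by (simp add: blinfun.bilinear_simps inner_diff inner_commute power4_eq_xxxx power2_eq_square)

text \<open>
  If \<open>C\<close> inverts \<open>m\<^sup>2 - S\<^sup>2\<close> for \<open>m = \<parallel>S\<parallel>\<close>, then \<open>\<parallel>S x\<parallel>\<^sup>2 \<le> (m\<^sup>2 - (m \<parallel>C\<parallel>)\<^sup>-\<^sup>2) \<parallel>x\<parallel>\<^sup>2\<close>, which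
  contradicts the choice of \<open>m\<close>.
\<close>

lemma self_adjoint_norm_not_invertible:
  fixes S :: "'a::chilbert_space \<Rightarrow>\<^sub>L 'a" and x0 :: 'a
  assumes S: "self_adjoint S" and x0: "x0 \<noteq> 0"
  shows "\<not> boundedly_invertible ((norm S)\<^sup>2 *\<^sub>R id_blinfun - (S o\<^sub>L S))"
proof
  define m where "m = norm S"
  let ?T = "m\<^sup>2 *\<^sub>R id_blinfun - (S o\<^sub>L S)"
  assume "boundedly_invertible ((norm S)\<^sup>2 *\<^sub>R id_blinfun - (S o\<^sub>L S))"
  then obtain C where C: "C o\<^sub>L ?T = id_blinfun"
    by (auto simp: boundedly_invertible_def is_inverse_op_def m_def)
  define c where "c = norm C"
  have key: "(norm x)\<^sup>2 \<le> (c * m)\<^sup>2 * (m\<^sup>2 * (norm x)\<^sup>2 - (norm (S x))\<^sup>2)" for x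
  proof -
    have "norm (S (S x)) \<le> m * norm (S x)"
      unfolding m_def by (rule norm_blinfun)
    then have "(norm (S (S x)))\<^sup>2 \<le> m\<^sup>2 * (norm (S x))\<^sup>2"
      by (metis norm_ge_zero power_mono power_mult_distrib)
    then have T: "(norm (?T x))\<^sup>2 \<le> m\<^sup>2 * (m\<^sup>2 * (norm x)\<^sup>2 - (norm (S x))\<^sup>2)"
      unfolding norm_square_diff_self_adjoint[OF S]
      by (simp add: algebra_simps power4_eq_xxxx power2_eq_square)
    have "x = C (?T x)"
      using C by (metis blinfun_apply_blinfun_compose blinfun_apply_id_blinfun)
    then have "norm x \<le> c * norm (?T x)"
      unfolding c_def by (metis norm_blinfun)
    then have "(norm x)\<^sup>2 \<le> c\<^sup>2 * (norm (?T x))\<^sup>2"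
      by (metis norm_ge_zero power_mono power_mult_distrib)
    also have "\<dots> \<le> c\<^sup>2 * (m\<^sup>2 * (m\<^sup>2 * (norm x)\<^sup>2 - (norm (S x))\<^sup>2))"
      by (intro mult_left_mono T) simp
    finally show ?thesis by (simp add: power_mult_distrib mult.assoc)
  qed
  \<comment> \<open>Otherwise \<open>key\<close> would give ||x0||^2 \<le> 0.\<close>
  have "c * m \<noteq> 0"
    using key[of x0] x0 by auto
  define k where "k = m\<^sup>2 - 1 / (c * m)\<^sup>2"
  have Sx: "(norm (S x))\<^sup>2 \<le> k * (norm x)\<^sup>2" for x
    using key[of x] \<open>c * m \<noteq> 0\<close> by (simp add: k_def field_simps)
  have "0 \<le> k * (norm x0)\<^sup>2"
    by (rule order_trans[OF zero_le_power2 Sx])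
  then have k: "0 \<le> k"
    using x0 by (simp add: zero_le_mult_iff)
  have "norm (S x) \<le> sqrt k * norm x" for x
    using real_sqrt_le_mono[OF Sx[of x]] by (simp add: real_sqrt_mult)
  then have "m \<le> sqrt k"
    unfolding m_def using k by (intro norm_blinfun_bound) auto
  then have "m\<^sup>2 \<le> k"
    using k power_mono[of m "sqrt k" 2] by (simp add: m_def)
  then show False
    using \<open>c * m \<noteq> 0\<close> by (simp add: k_def)
qed

text \<open>With C = B - Re z, the product (z - B)(cnj z - B) equals (Im z)^2 + C^2 = d - N, where N
  = ||C||^2 - C^2 and d = ||C||^2 + (Im z)^2. As ||N|| \<le> ||C||^2 < d for nonreal z, the Neumann
  series inverts it.\<close>

lemma spectrum_self_adjoint_real:
  fixes B :: "'a::chilbert_space \<Rightarrow>\<^sub>L 'a"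
  assumes B: "self_adjoint B" and lin: "complex_linear_op B" and z: "z \<in> spectrum B"
  shows "z = complex_of_real (Re z)"
proof (rule ccontr)
  assume "z \<noteq> complex_of_real (Re z)"
  then have Im: "Im z \<noteq> 0"
    by (simp add: complex_eq_iff)
  define C where "C = B - Re z *\<^sub>R id_blinfun"
  have C: "self_adjoint C"
    using B by (simp add: self_adjoint_def is_adjoint_iff C_def blinfun.bilinear_simps inner_diff)
  define N where "N = (norm C)\<^sup>2 *\<^sub>R id_blinfun - (C o\<^sub>L C)"
  have "norm (N x) \<le> (norm C)\<^sup>2 * norm x" for x
  proof (rule power2_le_imp_le)
    have "norm (C (C x)) \<le> norm C * norm (C x)"
      by (rule norm_blinfun)
    then have "(norm (C (C x)))\<^sup>2 \<le> (norm C)\<^sup>2 * (norm (C x))\<^sup>2"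
      by (metis norm_ge_zero power_mono power_mult_distrib)
    moreover have "0 \<le> (norm C)\<^sup>2 * (norm (C x))\<^sup>2"
      by simp
    ultimately have "(norm (C (C x)))\<^sup>2 \<le> 2 * (norm C)\<^sup>2 * (norm (C x))\<^sup>2"
      by linarith
    then show "(norm (N x))\<^sup>2 \<le> ((norm C)\<^sup>2 * norm x)\<^sup>2"
      unfolding N_def norm_square_diff_self_adjoint[OF C] power_mult_distrib
      by (simp flip: power_mult)
  qed simp
  then have N: "norm N \<le> (norm C)\<^sup>2"
    by (intro norm_blinfun_bound) simp_all
  define d where "d = (norm C)\<^sup>2 + (Im z)\<^sup>2"
  have d: "norm N < d" "0 < d"
    using N Im unfolding d_def by (smt (verit) norm_ge_zero zero_less_power2)+
  have "boundedly_invertible (d *\<^sub>R (id_blinfun - (1 / d) *\<^sub>R N))"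
    using d by (intro boundedly_invertible_scaleR boundedly_invertible_id_minus) simp_all
  also have "d *\<^sub>R (id_blinfun - (1 / d) *\<^sub>R N) = (Im z)\<^sup>2 *\<^sub>R id_blinfun + (C o\<^sub>L C)"
    using d by (simp add: N_def scaleR_diff_right) (simp add: d_def scaleR_add_left)
  finally have inv: "boundedly_invertible ((Im z)\<^sup>2 *\<^sub>R id_blinfun + (C o\<^sub>L C))" .
  have prod: "(scalar_op w - B) o\<^sub>L (scalar_op (cnj w) - B)
      = (cmod w)\<^sup>2 *\<^sub>R id_blinfun - (2 * Re w) *\<^sub>R B + (B o\<^sub>L B)" for w
  proof -
    have "(scalar_op w - B) o\<^sub>L (scalar_op (cnj w) - B)
        = scalar_op (w * cnj w) - (scalar_op (w + cnj w) o\<^sub>L B) + (B o\<^sub>L B)"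
      using complex_linear_op_commute[OF lin, of "cnj w"]
      by (simp add: blinfun_compose_bilinear scalar_op_mult scalar_op_add)
    moreover have "w * cnj w = complex_of_real ((cmod w)\<^sup>2)"
      by (rule complex_norm_square[symmetric])
    ultimately show ?thesis
      by (simp only: complex_add_cnj scalar_op_of_real blinfun_compose_bilinear blinfun_compose_id)
  qed
  have "C o\<^sub>L C = (B o\<^sub>L B) - (2 * Re z) *\<^sub>R B + (Re z)\<^sup>2 *\<^sub>R id_blinfun"
    using scaleR_add_left[of "Re z" "Re z" B]
    by (simp add: C_def blinfun_compose_bilinear power2_eq_square scaleR_diff_right)
  then have "(Im z)\<^sup>2 *\<^sub>R id_blinfun + (C o\<^sub>L C)
      = (scalar_op z - B) o\<^sub>L (scalar_op (cnj z) - B)"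
    by (simp add: prod cmod_power2 scaleR_add_left)
  with inv have "boundedly_invertible ((scalar_op z - B) o\<^sub>L (scalar_op (cnj z) - B))"
    by (simp only:)
  moreover have "(scalar_op z - B) o\<^sub>L (scalar_op (cnj z) - B)
      = (scalar_op (cnj z) - B) o\<^sub>L (scalar_op z - B)"
    using prod[of z] prod[of "cnj z"] by (simp only: complex_cnj_cnj complex_mod_cnj cnj.sel)
  ultimately have "boundedly_invertible (scalar_op z - B)"
    by (rule boundedly_invertible_compose_commute)
  then show False
    using z by (simp add: spectrum_def)
qed

section \<open>Polynomials in a complex linear operator\<close>

lemma poly_op_upto:
  assumes "degree p \<le> n"
  shows "poly_op p B = (\<Sum>k\<le>n. scalar_op (coeff p k) o\<^sub>L power_op B k)"
  unfolding poly_op_def using assms by (intro sum.mono_neutral_left) (auto simp: coeff_eq_0)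

lemma poly_op_0 [simp]: "poly_op 0 B = 0"
  by (simp add: poly_op_def)

text \<open>The Horner step behind the inductions on polynomials; complex linearity lets
  \<open>B\<close> pass the coefficients.\<close>

lemma poly_op_pCons:
  assumes "complex_linear_op B"
  shows "poly_op (pCons a p) B = scalar_op a + (B o\<^sub>L poly_op p B)"
proof -
  have "poly_op (pCons a p) B
      = (\<Sum>k\<le>Suc (degree p). scalar_op (coeff (pCons a p) k) o\<^sub>L power_op B k)"
    by (rule poly_op_upto) (rule degree_pCons_le)
  also have "\<dots> = scalar_op a + (\<Sum>k\<le>degree p. scalar_op (coeff p k) o\<^sub>L (B o\<^sub>L power_op B k))"
    by (simp add: sum.atMost_Suc_shift del: sum.atMost_Suc)
  also have "(\<Sum>k\<le>degree p. scalar_op (coeff p k) o\<^sub>L (B o\<^sub>L power_op B k)) = B o\<^sub>L poly_op p B"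
    unfolding poly_op_def bounded_bilinear.sum_right[OF bounded_bilinear_blinfun_compose]
    by (intro sum.cong refl)
      (simp add: complex_linear_op_commute[OF assms] flip: blinfun_compose_assoc)
  finally show ?thesis .
qed

lemma poly_op_add: "poly_op (p + q) B = poly_op p B + poly_op q B"
proof -
  define n where "n = max (degree p) (degree q)"
  have "degree p \<le> n" "degree q \<le> n" "degree (p + q) \<le> n"
    by (auto simp: n_def degree_add_le_max)
  then show ?thesis
    by (simp add: poly_op_upto[of _ n] sum.distrib scalar_op_add blinfun_compose_bilinear)
qed

lemma poly_op_smult: "poly_op (smult a p) B = scalar_op a o\<^sub>L poly_op p B"
  using poly_op_upto[OF degree_smult_le, of a p B] unfolding poly_op_def[of p]
  by (simp add: bounded_bilinear.sum_right[OF bounded_bilinear_blinfun_compose]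
      scalar_op_mult blinfun_compose_assoc)

lemma poly_op_diff: "poly_op (p - q) B = poly_op p B - poly_op q B"
  using poly_op_add[of "p - q" q B] by (simp add: eq_diff_eq)

lemma poly_op_mult:
  assumes "complex_linear_op B"
  shows "poly_op (p * q) B = poly_op p B o\<^sub>L poly_op q B"
  by (induction p)
    (simp_all add: mult_pCons_left poly_op_add poly_op_smult poly_op_pCons[OF assms]
      blinfun_compose_bilinear blinfun_compose_assoc)

lemma is_adjoint_poly_op:
  assumes "self_adjoint B" "complex_linear_op B"
  shows "is_adjoint (poly_op p B) (poly_op (map_poly cnj p) B)"
proof (induction p)
  case 0
  then show ?case by (simp add: is_adjoint_iff)
next
  case (pCons a p)
  \<comment> \<open>Multiplying by the polynomial X from either side shows this; it undoes the
    reversal of factors caused by taking adjoints.\<close>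
  have commute: "C o\<^sub>L B = B o\<^sub>L C" if "C = poly_op (map_poly cnj p) B" for C
    using poly_op_mult[OF assms(2), of "[:0, 1:]" "map_poly cnj p"]
      poly_op_mult[OF assms(2), of "map_poly cnj p" "[:0, 1:]"]
    by (simp add: poly_op_pCons[OF assms(2)] that)
  have "is_adjoint (scalar_op a + (B o\<^sub>L poly_op p B))
      (scalar_op (cnj a) + (poly_op (map_poly cnj p) B o\<^sub>L B))"
    using pCons assms
    by (intro is_adjoint_add is_adjoint_scalar_op is_adjoint_compose) (simp_all add: self_adjoint_def)
  then show ?case
    by (simp add: poly_op_pCons[OF assms(2)] map_poly_pCons commute)
qed

text \<open>One half of spectral mapping: linear factors with roots off the spectrum are invertible
  and can be cancelled. If all roots were such, an invertible nonzero constant would remain.\<close>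

lemma poly_op_root_in_spectrum:
  fixes B :: "'a::chilbert_space \<Rightarrow>\<^sub>L 'a"
  assumes lin: "complex_linear_op B"
    and "q \<noteq> 0" "\<not> boundedly_invertible (poly_op q B)"
  shows "\<exists>z\<in>spectrum B. poly q z = 0"
  using assms(2,3)
proof (induction "degree q" arbitrary: q)
  case 0
  then obtain a where "q = [:a:]" "a \<noteq> 0"
    by (metis degree_eq_zeroE pCons_0_0)
  then show ?case
    using 0 boundedly_invertible_scalar_op[of a, where 'a = 'a] by (simp add: poly_op_pCons[OF lin])
next
  case (Suc n)
  then have "\<not> constant (poly q)"
    by (simp add: constant_degree)
  then obtain z where z: "poly q z = 0"
    using fundamental_theorem_of_algebra by blast
  then obtain r where q: "q = [:- z, 1:] * r"
    by (auto simp: poly_eq_0_iff_dvd)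
  show ?case
  proof (cases "z \<in> spectrum B")
    case True
    then show ?thesis using z by blast
  next
    case False
    then have "boundedly_invertible (-1 *\<^sub>R (scalar_op z - B))"
      by (intro boundedly_invertible_scaleR) (simp_all add: spectrum_def)
    moreover have "poly_op q B = (-1 *\<^sub>R (scalar_op z - B)) o\<^sub>L poly_op r B"
      unfolding q poly_op_mult[OF lin] by (simp add: poly_op_pCons[OF lin] scalar_op_minus)
    ultimately have "\<not> boundedly_invertible (poly_op r B)"
      using Suc.prems boundedly_invertible_compose by metis
    moreover have "r \<noteq> 0"
      using Suc.prems(1) q by auto
    moreover from this have "degree q = Suc (degree r)"
      unfolding q by (subst degree_mult_eq) auto
    ultimately have "\<exists>z\<in>spectrum B. poly r z = 0"
      using Suc.hyps by (metis nat.inject)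
    then show ?thesis
      unfolding q by auto
  qed
qed

text \<open>For S = p(B)* p(B) = r(B), non-invertibility of ||S||^2 - S^2 yields a spectral root of
  ||S||^2 - r^2. That root z is real, so r(z) = |p(z)|^2 and ||S|| = |p(z)|^2 \<le> c^2, while
  ||p(B)||^2 \<le> ||S||.\<close>

lemma norm_poly_op_le:
  fixes B :: "'a::chilbert_space \<Rightarrow>\<^sub>L 'a"
  assumes B: "self_adjoint B" and lin: "complex_linear_op B"
    and c: "\<And>z. z \<in> spectrum B \<Longrightarrow> cmod (poly p z) \<le> c" "0 \<le> c"
  shows "norm (poly_op p B) \<le> c"
proof (cases "\<exists>x0::'a. x0 \<noteq> 0")
  case False
  then have "poly_op p B = 0"
    by (intro blinfun_eqI) metis
  then show ?thesis
    using c(2) by simp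
next
  case True
  then obtain x0 :: 'a where x0: "x0 \<noteq> 0" by blast
  have root: "\<exists>z\<in>spectrum B. poly q z = 0"
    if "q = [:complex_of_real ((norm (poly_op r B))\<^sup>2):] - r * r" "q \<noteq> 0"
      "self_adjoint (poly_op r B)" for q r
  proof (rule poly_op_root_in_spectrum[OF lin that(2)])
    have "poly_op q B = (norm (poly_op r B))\<^sup>2 *\<^sub>R id_blinfun - (poly_op r B o\<^sub>L poly_op r B)"
      unfolding that(1) by (simp only: poly_op_diff poly_op_mult[OF lin])
        (simp add: poly_op_pCons[OF lin] flip: scalar_op_of_real)
    then show "\<not> boundedly_invertible (poly_op q B)"
      using self_adjoint_norm_not_invertible[OF that(3) x0] by simp
  qed
  \<comment> \<open>The nonzero polynomial ||B||^2 - X^2 has a spectral root. Nonemptiness is used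
    below if \<open>q = 0\<close>, where every spectral point is a root.\<close>
  have nonempty: "spectrum B \<noteq> {}"
  proof -
    have "poly_op [:0, 1:] B = B"
      by (simp add: poly_op_pCons[OF lin])
    then show ?thesis
      using root[of _ "[:0, 1:]"] B by auto
  qed
  let ?T = "poly_op p B"
  define r where "r = map_poly cnj p * p"
  define S where "S = poly_op r B"
  have S: "S = poly_op (map_poly cnj p) B o\<^sub>L ?T"
    by (simp add: S_def r_def poly_op_mult[OF lin])
  have adj: "is_adjoint ?T (poly_op (map_poly cnj p) B)"
    by (rule is_adjoint_poly_op[OF B lin])
  have "is_adjoint (poly_op (map_poly cnj p) B) ?T"
    using is_adjoint_poly_op[OF B lin, of "map_poly cnj p"] by (simp add: map_poly_map_poly o_def)
  then have "self_adjoint S"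
    unfolding S self_adjoint_def using adj by (rule is_adjoint_compose)
  have "(norm (?T x))\<^sup>2 \<le> norm S * (norm x)\<^sup>2" for x
  proof -
    have "(norm (?T x))\<^sup>2 = inner x (S x)"
      unfolding power2_norm_eq_inner S using is_adjointD[OF adj] by simp
    also have "\<dots> \<le> norm x * norm (S x)"
      by (rule norm_cauchy_schwarz)
    also have "\<dots> \<le> norm x * (norm S * norm x)"
      by (intro mult_left_mono norm_blinfun) simp
    finally show ?thesis by (simp add: power2_eq_square mult_ac)
  qed
  then have "norm (?T x) \<le> sqrt (norm S) * norm x" for x
    by (metis norm_ge_zero real_le_lsqrt real_sqrt_mult real_sqrt_abs abs_norm_cancel real_le_rsqrt)
  then have "norm ?T \<le> sqrt (norm S)"
    by (intro norm_blinfun_bound) auto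
  moreover have "norm S \<le> c\<^sup>2"
  proof -
    define q where "q = [:complex_of_real ((norm S)\<^sup>2):] - r * r"
    obtain z where z: "z \<in> spectrum B" "poly q z = 0"
      using root[OF q_def[unfolded S_def]] \<open>self_adjoint S\<close> nonempty
      by (cases "q = 0") (auto simp: S_def)
    have "cnj z = z"
      using spectrum_self_adjoint_real[OF B lin z(1)] by (metis complex_cnj_complex_of_real)
    then have "poly r z = complex_of_real ((cmod (poly p z))\<^sup>2)"
      unfolding complex_norm_square by (simp add: r_def mult.commute)
    then have "(norm S)\<^sup>2 = ((cmod (poly p z))\<^sup>2)\<^sup>2"
      using z(2) by (simp add: q_def power2_eq_square flip: of_real_mult of_real_power)
    then have "norm S = (cmod (poly p z))\<^sup>2"
      by (rule power2_eq_imp_eq) simp_all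
    also have "\<dots> \<le> c\<^sup>2"
      using c z by (intro power_mono) auto
    finally show ?thesis .
  qed
  ultimately show ?thesis
    using c(2) real_sqrt_le_mono by fastforce
qed

section \<open>Uniform approximation and existence of the functional calculus\<close>

lemma real_polynomial_function_imp_complex_poly:
  assumes "real_polynomial_function (g :: real \<Rightarrow> real)"
  shows "\<exists>p. \<forall>t. poly p (complex_of_real t) = complex_of_real (g t)"
proof -
  obtain a n where g: "g = (\<lambda>x. \<Sum>i\<le>n. a i * x ^ i)"
    using assms unfolding real_polynomial_function_iff_sum by blast
  show ?thesis
    by (rule exI[of _ "\<Sum>i\<le>n. monom (complex_of_real (a i)) i"])
      (simp add: g poly_sum poly_monom)
qed

text \<open>The spectrum is a compact set of reals, so Stone-Weierstrass applies to the real and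
  imaginary parts of \<open>u\<close> separately, each within e/2.\<close>

lemma uniform_limit_poly_spectrum:
  fixes B :: "'a::chilbert_space \<Rightarrow>\<^sub>L 'a"
  assumes B: "self_adjoint B" and lin: "complex_linear_op B"
    and u: "continuous_on (spectrum B) u"
  shows "\<exists>p. uniform_limit (spectrum B) (\<lambda>n. poly (p n)) u sequentially"
proof -
  define K where "K = Re ` spectrum B"
  have real: "complex_of_real (Re z) = z" if "z \<in> spectrum B" for z
    using spectrum_self_adjoint_real[OF B lin that] by simp
  have K: "compact K"
    unfolding K_def by (intro compact_continuous_image compact_spectrum continuous_intros)
  have cont: "continuous_on K (\<lambda>t. u (complex_of_real t))"
    by (rule continuous_on_compose2[OF u]) (auto intro!: continuous_intros simp: K_def real)
  have "\<exists>p. \<forall>z\<in>spectrum B. dist (poly p z) (u z) < e" if e: "0 < e" for e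
  proof -
    obtain g where g: "real_polynomial_function g"
      "\<And>t. t \<in> K \<Longrightarrow> \<bar>Re (u (complex_of_real t)) - g t\<bar> < e / 2"
      by (rule Stone_Weierstrass_real_polynomial_function[OF K continuous_on_Re[OF cont], of "e / 2"])
        (use e in auto)
    obtain h where h: "real_polynomial_function h"
      "\<And>t. t \<in> K \<Longrightarrow> \<bar>Im (u (complex_of_real t)) - h t\<bar> < e / 2"
      by (rule Stone_Weierstrass_real_polynomial_function[OF K continuous_on_Im[OF cont], of "e / 2"])
        (use e in auto)
    obtain p q where p: "\<And>t. poly p (complex_of_real t) = complex_of_real (g t)"
      and q: "\<And>t. poly q (complex_of_real t) = complex_of_real (h t)"
      using real_polynomial_function_imp_complex_poly g h by metis
    have "dist (poly (p + smult \<i> q) z) (u z) < e" if z: "z \<in> spectrum B" for z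
    proof -
      have "poly (p + smult \<i> q) z = Complex (g (Re z)) (h (Re z))"
        using p[of "Re z"] q[of "Re z"] real[OF z] by (simp add: complex_eq_iff)
      then have "dist (poly (p + smult \<i> q) z) (u z)
          \<le> \<bar>g (Re z) - Re (u z)\<bar> + \<bar>h (Re z) - Im (u z)\<bar>"
        using cmod_le[of "Complex (g (Re z)) (h (Re z)) - u z"] by (simp add: dist_norm)
      also have "\<dots> < e"
        using g(2)[of "Re z"] h(2)[of "Re z"] z real[OF z] by (simp add: K_def abs_minus_commute)
      finally show ?thesis .
    qed
    then show ?thesis by blast
  qed
  then have "\<exists>p. \<forall>z\<in>spectrum B. dist (poly p z) (u z) < inverse (real (Suc n))" for n
    by simp
  then obtain p where p: "\<And>n z. z \<in> spectrum B \<Longrightarrow> dist (poly (p n) z) (u z) < inverse (real (Suc n))"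
    by metis
  have "uniform_limit (spectrum B) (\<lambda>n. poly (p n)) u sequentially"
    unfolding uniform_limit_iff
  proof (intro allI impI)
    fix e :: real assume "0 < e"
    then have "\<forall>\<^sub>F n in sequentially. inverse (real (Suc n)) < e"
      using LIMSEQ_inverse_real_of_nat order_tendstoD(2) by blast
    then show "\<forall>\<^sub>F n in sequentially. \<forall>z\<in>spectrum B. dist (poly (p n) z) (u z) < e"
      by eventually_elim (use p in \<open>force intro: less_trans\<close>)
  qed
  then show ?thesis by blast
qed

lemma dist_poly_op_le:
  assumes "self_adjoint B" "complex_linear_op B" "0 \<le> e"
    and "\<And>z. z \<in> spectrum B \<Longrightarrow> dist (poly p z) (u z) < e / 2"
    and "\<And>z. z \<in> spectrum B \<Longrightarrow> dist (poly q z) (u z) < e / 2"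
  shows "dist (poly_op p B) (poly_op q B) \<le> e"
  unfolding dist_norm poly_op_diff[symmetric]
proof (rule norm_poly_op_le[OF assms(1,2) _ assms(3)])
  fix z assume "z \<in> spectrum B"
  then have "dist (poly p z) (poly q z) < e"
    using assms(4,5) by (metis dist_triangle_half_l)
  then show "cmod (poly (p - q) z) \<le> e"
    by (simp add: dist_norm)
qed

text \<open>The norm bound makes polynomial approximants Cauchy and gives all approximating
  sequences the same limit, so the description in \<open>cfc\<close> denotes.\<close>

lemma cfc_LIMSEQ:
  fixes B :: "'a::chilbert_space \<Rightarrow>\<^sub>L 'a"
  assumes B: "self_adjoint B" and lin: "complex_linear_op B"
    and u: "continuous_on (spectrum B) u"
  shows "\<exists>p. uniform_limit (spectrum B) (\<lambda>n. poly (p n)) u sequentially \<and>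
    (\<lambda>n. poly_op (p n) B) \<longlonglongrightarrow> cfc u B"
proof -
  obtain p where p: "uniform_limit (spectrum B) (\<lambda>n. poly (p n)) u sequentially"
    using uniform_limit_poly_spectrum[OF B lin u] by blast
  have eventually: "\<forall>\<^sub>F n in sequentially. \<forall>z\<in>spectrum B. dist (poly (q n) z) (u z) < e / 2"
    if "uniform_limit (spectrum B) (\<lambda>n. poly (q n)) u sequentially" "0 < e"
    for q :: "nat \<Rightarrow> complex poly" and e :: real
    using that by (intro uniform_limitD) auto
  have "Cauchy (\<lambda>n. poly_op (p n) B)"
    unfolding Cauchy_altdef2
  proof (intro allI impI)
    fix e :: real assume "0 < e"
    then obtain N where N: "\<forall>n\<ge>N. \<forall>z\<in>spectrum B. dist (poly (p n) z) (u z) < (e / 2) / 2"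
      using eventually[OF p, of "e / 2"] unfolding eventually_sequentially by auto
    have "dist (poly_op (p n) B) (poly_op (p N) B) < e" if "n \<ge> N" for n
    proof -
      have "dist (poly_op (p n) B) (poly_op (p N) B) \<le> e / 2"
        using N that \<open>0 < e\<close> by (intro dist_poly_op_le[OF B lin, of _ _ u]) auto
      also have "\<dots> < e"
        using \<open>0 < e\<close> by simp
      finally show ?thesis .
    qed
    then show "\<exists>N. \<forall>n\<ge>N. dist (poly_op (p n) B) (poly_op (p N) B) < e"
      by blast
  qed
  then obtain T where T: "(\<lambda>n. poly_op (p n) B) \<longlonglongrightarrow> T"
    using Cauchy_convergent convergentD by blast
  have T_unique: "(\<lambda>n. poly_op (q n) B) \<longlonglongrightarrow> T"
    if q: "uniform_limit (spectrum B) (\<lambda>n. poly (q n)) u sequentially" for q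
  proof (rule Lim_transform[OF T], rule tendstoI)
    fix e :: real assume "0 < e"
    then have "0 < e / 2" by simp
    show "\<forall>\<^sub>F n in sequentially. dist (poly_op (q n) B - poly_op (p n) B) 0 < e"
      using eventually[OF p \<open>0 < e / 2\<close>] eventually[OF q \<open>0 < e / 2\<close>]
    proof eventually_elim
      case (elim n)
      then have "dist (poly_op (q n) B) (poly_op (p n) B) \<le> e / 2"
        using \<open>0 < e\<close> by (intro dist_poly_op_le[OF B lin, of _ _ u]) auto
      then show ?case
        using \<open>0 < e\<close> by (simp add: dist_norm)
    qed
  qed
  have "cfc u B = T"
    unfolding cfc_def
  proof (rule the_equality)
    \<comment> \<open>The approximating sequence \<open>p\<close> already found pins
      \<open>T'\<close> down; without one the condition would be vacuous.\<close>
    show "T' = T" if "\<forall>p. uniform_limit (spectrum B) (\<lambda>n. poly (p n)) u sequentially \<longrightarrow>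
        (\<lambda>n. poly_op (p n) B) \<longlonglongrightarrow> T'" for T'
      using that p T LIMSEQ_unique by blast
  qed (use T_unique in blast)
  then show ?thesis
    using p T by blast
qed

text \<open>Since |z|^2 lies in the spectrum of A^2, uniform approximation there includes
  convergence at this point. Each polynomial stage satisfies the inclusion, and
  \<open>spectrum_LIMSEQ\<close> finishes.\<close>

lemma biradial_spectrum:
  assumes A: "antilinear A" "self_adjoint A" and z: "z \<in> spectrum A"
    and u: "continuous_on (spectrum (A o\<^sub>L A)) u" and v: "continuous_on (spectrum (A o\<^sub>L A)) v"
  shows "biradial u v z \<in> spectrum (cfc u (A o\<^sub>L A) + (cfc v (A o\<^sub>L A) o\<^sub>L A))"
proof -
  let ?B = "A o\<^sub>L A" and ?t = "complex_of_real ((cmod z)\<^sup>2)"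
  have B: "self_adjoint ?B" "complex_linear_op ?B"
    using A by (auto simp: self_adjoint_def is_adjoint_compose complex_linear_op_antilinear_square)
  obtain p q where
    p: "uniform_limit (spectrum ?B) (\<lambda>n. poly (p n)) u sequentially"
      "(\<lambda>n. poly_op (p n) ?B) \<longlonglongrightarrow> cfc u ?B" and
    q: "uniform_limit (spectrum ?B) (\<lambda>n. poly (q n)) v sequentially"
      "(\<lambda>n. poly_op (q n) ?B) \<longlonglongrightarrow> cfc v ?B"
    using cfc_LIMSEQ[OF B u] cfc_LIMSEQ[OF B v] by blast
  have t: "?t \<in> spectrum ?B"
    by (rule spectrum_antilinear_square[OF A(1) z])
  show ?thesis
  proof (rule spectrum_LIMSEQ)
    show "(\<lambda>n. poly (p n) ?t + poly (q n) ?t * z) \<longlonglongrightarrow> biradial u v z"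
      unfolding biradial_def
      by (intro tendsto_intros tendsto_uniform_limitI[OF p(1) t] tendsto_uniform_limitI[OF q(1) t])
    show "(\<lambda>n. poly_op (p n) ?B + (poly_op (q n) ?B o\<^sub>L A)) \<longlonglongrightarrow> cfc u ?B + (cfc v ?B o\<^sub>L A)"
      by (intro tendsto_add p(2) bounded_bilinear.tendsto[OF bounded_bilinear_blinfun_compose]
          q(2) tendsto_const)
    show "poly (p n) ?t + poly (q n) ?t * z
        \<in> spectrum (poly_op (p n) ?B + (poly_op (q n) ?B o\<^sub>L A))" for n
      by (intro spectrum_antilinear_cong_scalar[OF A(1) z] cong_scalar_poly B(2))
  qed
qed

theorem theorem2p6:
  fixes A :: "'a::chilbert_space \<Rightarrow>\<^sub>L 'a"
  assumes "antilinear A"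
  shows "(\<forall>(\<alpha> :: int \<Rightarrow> complex) (D :: complex set).
            laurent_region \<alpha> D \<longrightarrow> laurent_converges_on \<alpha> D \<longrightarrow>
            spectrum A \<subseteq> D \<longrightarrow> laurent_op_defined \<alpha> A \<longrightarrow>
            laurent_hat \<alpha> ` spectrum A \<subseteq> spectrum (laurent_op \<alpha> A))
       \<and> (self_adjoint A \<longrightarrow>
            (\<forall>u v :: complex \<Rightarrow> complex.
               continuous_on (spectrum (A o\<^sub>L A)) u \<longrightarrow>
               continuous_on (spectrum (A o\<^sub>L A)) v \<longrightarrow>
               biradial u v ` spectrum A
                 \<subseteq> spectrum (cfc u (A o\<^sub>L A) + (cfc v (A o\<^sub>L A) o\<^sub>L A))))"
  using laurent_hat_spectrum[OF assms] biradial_spectrum[OF assms] by blast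

end
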